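(* Let $\mathcal H$, $f$, $\psi$, $u$, $\Theta$, $h$, $t_k=kh$, $\zeta\in[0,1]$, $\hat\zeta=1-\zeta$ and the parameter sequence $(\theta_k)$ of the discretize-then-parametrize $\zeta$-method be as in the context, let $$\rho=\max\{\|r_k(\theta_{k+1})\| : 0\le t_{k+1}\le T\},$$ and let $$c_1=\Big(\big|\tfrac12-\zeta\big|+\tfrac14\Big)\max_{t\in[0,T]}\|\psi''(t)\|\quad\text{if }\zeta\in[0,1]\text{ and }\psi\in C^2([0,T],\mathcal H),$$ $$c_2=\tfrac1{12}\max_{t\in[0,T]}\|\psi'''(t)\|\quad\text{if }\zeta=\tfrac12\text{ and }\psi\in C^3([0,T],\mathcal H).$$ Below, $s=1$ is used when $\psi\in C^2([0,T],\mathcal H)$ and $s=2$ is used only when $\zeta=\tfrac12$ and $\psi\in C^3([0,T],\mathcal H)$. Consider any one of the following three cases. (Lip) There is a constant $\lambda>0$ such that $\|f(t,v)-f(t,w)\|\le\lambda\|v-w\|$ for all $t\in[0,T]$ and $v,w\in\mathcal H$. Then choose $\zeta\in[0,1]$ and $s\in\{1,2\}$. Choose $C>1$ and consider a sufficiently small $h>0$ satisfying $\lambda\hat\zeta h<\frac1C<1$. Set $C_0=e^{C\lambda T}$ and $M=C_0/\lambda$. Define $E_0=C_0\|\psi(t_0)-u(\theta_0)\|$. (os-Lip) There is a constant $\ell\in\mathbb R$ such that $\operatorname{Re}\langle f(t,v)-f(t,w),v-w\rangle\le\ell\|v-w\|^2$ for all $t\in[0,T]$ and $v,w\in\mathcal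 H$. Then choose $\zeta=0$ (implicit Euler) and $s=1$. Consider a sufficiently small $h>0$ satisfying the (possible) restriction $\ell h\le\frac12$. Set $$(C_0,M)=\begin{cases}(1,\,T),&\ell=0,\\ (1,\,1/|\ell|),&\ell<0,\\ e^{2\ell T}(1,\,1/\ell),&\ell>0,\end{cases}$$ and define $E_0=C_0\|\psi(t_0)-u(\theta_0)\|$. (diss) The one-sided Lipschitz condition of (os-Lip) holds with $\ell=0$. Then choose $\zeta\le\frac12$ and $s\in\{1,2\}$. Set $M=T$ and define $E_0\ge0$ by $$E_0^2=\|\psi(t_0)-u(\theta_0)\|^2+\zeta^2h^2\|f(t_0,\psi(t_0))-f(t_0,u(\theta_0))\|^2 .$$ Then, in each of these three cases, the error of the discretize-then-parametrize $\zeta$-method satisfies $$\|\psi(t_k)-u(\theta_k)\|\le E_0+M\Big(\frac{\rho}{h}+c_s h^s\Big)$$ for all $t_{k+1}=(k+1)h\le T$.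
   Context: $\mathcal H$ is a complex Hilbert space (e.g. $L^2(\Omega,\mathbb C)$, $\Omega\subseteq\mathbb R^d$) with inner product $\langle\cdot,\cdot\rangle$ and norm $\|\cdot\|$. $T>0$ and $f:[0,T]\times\mathcal H\to\mathcal H$, $(t,v)\mapsto f(t,v)$ (the spatial variable is suppressed). $\psi:[0,T]\to\mathcal H$ is a solution of $\psi'(t)=f(t,\psi(t))$, $\psi(0)=\psi_0\in\mathcal H$. $\Theta\subset\mathbb C^p$ is a parameter set and $u:\Theta\to\mathcal H$ a parametrization; no further structure is assumed of it. $h>0$ is a step-size and $t_k=kh$, $k\ge0$. Discretize-then-parametrize $\zeta$-method: $\zeta\in[0,1]$, $\hat\zeta=1-\zeta$. Given an initial parameter $\theta_0\in\Theta$, for $k=0,1,\dots$ (as long as $t_{k+1}\le T$) the parameter $\theta_{k+1}\in\Theta$ is a minimizer over $\theta\in\Theta$ of $\|r_k(\theta)\|$, where $$r_k(\theta)=u(\theta)-u(\theta_k)-h\big[\zeta f(t_k,u(\theta_k))+\hat\zeta f(t_{k+1},u(\theta))\big].$$ *)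

theory Defs
  imports "HOL-Analysis.Analysis"
begin

text \<open>Complex Hilbert spaces. The inner product is antilinear in the first and linear in the
  second argument; only its real part is used below, so this choice is immaterial.\<close>

class scaleC =
  fixes scaleC :: "complex \<Rightarrow> 'a \<Rightarrow> 'a" (infixr \<open>*\<^sub>C\<close> 75)

class complex_hilbert_space = banach + scaleC +
  fixes cinner :: "'a \<Rightarrow> 'a \<Rightarrow> complex"
  assumes scaleC_add_right: "a *\<^sub>C (x + y) = a *\<^sub>C x + a *\<^sub>C y"
    and scaleC_add_left: "(a + b) *\<^sub>C x = a *\<^sub>C x + b *\<^sub>C x"
    and scaleC_scaleC: "a *\<^sub>C b *\<^sub>C x = (a * b) *\<^sub>C x"
    and scaleR_scaleC: "r *\<^sub>R x = complex_of_real r *\<^sub>C x"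
    and cinner_commute: "cinner x y = cnj (cinner y x)"
    and cinner_add_right: "cinner x (y + z) = cinner x y + cinner x z"
    and cinner_scaleC_right: "cinner x (a *\<^sub>C y) = a * cinner x y"
    and cinner_ge_zero: "0 \<le> Re (cinner x x)"
    and cinner_eq_zero_iff: "cinner x x = 0 \<longleftrightarrow> x = 0"
    and norm_eq_sqrt_cinner: "norm x = sqrt (Re (cinner x x))"

instantiation complex :: complex_hilbert_space
begin

definition scaleC_complex :: "complex \<Rightarrow> complex \<Rightarrow> complex" where
  "scaleC_complex a x = a * x"

definition cinner_complex :: "complex \<Rightarrow> complex \<Rightarrow> complex" where
  "cinner_complex x y = cnj x * y"

instance
proof
  fix x :: complex
  show "norm x = sqrt (Re (cinner x x))"
    by (simp add: cinner_complex_def cmod_def power2_eq_square)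
qed (simp_all add: scaleC_complex_def cinner_complex_def algebra_simps scaleR_conv_of_real)

end

text \<open>Derivatives are taken within \<open>S\<close>, hence are one-sided at the end points of an interval.\<close>

primrec nth_vderiv :: "real set \<Rightarrow> nat \<Rightarrow> (real \<Rightarrow> 'a::real_normed_vector) \<Rightarrow> real \<Rightarrow> 'a" where
  "nth_vderiv S 0 g = g"
| "nth_vderiv S (Suc n) g = (\<lambda>t. vector_derivative (nth_vderiv S n g) (at t within S))"

definition C_k_on :: "nat \<Rightarrow> real set \<Rightarrow> (real \<Rightarrow> 'a::real_normed_vector) \<Rightarrow> bool" where
  "C_k_on n S g \<longleftrightarrow>
     (\<forall>j<n. \<forall>t\<in>S. nth_vderiv S j g differentiable (at t within S)) \<and>
     continuous_on S (nth_vderiv S n g)"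

definition ivp_solution ::
    "real \<Rightarrow> (real \<Rightarrow> 'a \<Rightarrow> 'a) \<Rightarrow> 'a \<Rightarrow> (real \<Rightarrow> 'a::real_normed_vector) \<Rightarrow> bool" where
  "ivp_solution T f \<psi>\<^sub>0 \<psi> \<longleftrightarrow>
     \<psi> 0 = \<psi>\<^sub>0 \<and> (\<forall>t\<in>{0..T}. (\<psi> has_vector_derivative f t (\<psi> t)) (at t within {0..T}))"

definition one_sided_lipschitz ::
    "real \<Rightarrow> (real \<Rightarrow> 'a \<Rightarrow> 'a::complex_hilbert_space) \<Rightarrow> real \<Rightarrow> bool" where
  "one_sided_lipschitz T f l \<longleftrightarrow>
     (\<forall>t\<in>{0..T}. \<forall>v w. Re (cinner (f t v - f t w) (v - w)) \<le> l * (norm (v - w))\<^sup>2)"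

text \<open>\<open>dtp_residual f u h \<zeta> k \<eta> \<theta>\<close> is \<open>r\<^sub>k(\<theta>)\<close> where \<open>\<eta>\<close> is the previous parameter \<open>\<theta>\<^sub>k\<close>.\<close>

definition dtp_residual ::
    "(real \<Rightarrow> 'a \<Rightarrow> 'a) \<Rightarrow> ('b \<Rightarrow> 'a) \<Rightarrow> real \<Rightarrow> real \<Rightarrow> nat \<Rightarrow> 'b \<Rightarrow> 'b \<Rightarrow> 'a::real_normed_vector" where
  "dtp_residual f u h \<zeta> k \<eta> \<theta> =
     u \<theta> - u \<eta> - h *\<^sub>R (\<zeta> *\<^sub>R f (real k * h) (u \<eta>) + (1 - \<zeta>) *\<^sub>R f (real (Suc k) * h) (u \<theta>))"

text \<open>Entries \<open>\<theta> k\<close> with \<open>k \<ge> 1\<close> and \<open>real k * h > T\<close> are unconstrained.\<close>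

definition dtp_sequence ::
    "real \<Rightarrow> (real \<Rightarrow> 'a \<Rightarrow> 'a::real_normed_vector) \<Rightarrow> 'b set \<Rightarrow> ('b \<Rightarrow> 'a) \<Rightarrow> real \<Rightarrow> real
      \<Rightarrow> (nat \<Rightarrow> 'b) \<Rightarrow> bool" where
  "dtp_sequence T f \<Theta> u h \<zeta> \<theta> \<longleftrightarrow>
     \<theta> 0 \<in> \<Theta> \<and>
     (\<forall>k. real (Suc k) * h \<le> T \<longrightarrow>
        is_arg_min (\<lambda>\<eta>. norm (dtp_residual f u h \<zeta> k (\<theta> k) \<eta>)) (\<lambda>\<eta>. \<eta> \<in> \<Theta>) (\<theta> (Suc k)))"

text \<open>For \<open>h > 0\<close> the maximum is over a finite set, which is nonempty iff \<open>h \<le> T\<close>.\<close>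

definition dtp_rho ::
    "real \<Rightarrow> (real \<Rightarrow> 'a \<Rightarrow> 'a::real_normed_vector) \<Rightarrow> ('b \<Rightarrow> 'a) \<Rightarrow> real \<Rightarrow> real
      \<Rightarrow> (nat \<Rightarrow> 'b) \<Rightarrow> real" where
  "dtp_rho T f u h \<zeta> \<theta> =
     Max {norm (dtp_residual f u h \<zeta> k (\<theta> k) (\<theta> (Suc k))) |k. real (Suc k) * h \<le> T}"

text \<open>The constants \<open>c\<^sub>1\<close> and \<open>c\<^sub>2\<close>. Under \<open>admissible_order\<close> the suprema are those of continuous
  functions on a compact interval, hence maxima.\<close>

definition trunc_const :: "real \<Rightarrow> (real \<Rightarrow> 'a::real_normed_vector) \<Rightarrow> real \<Rightarrow> nat \<Rightarrow> real" where
  "trunc_const T \<psi> \<zeta> s =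
     (if s = 1 then (\<bar>1/2 - \<zeta>\<bar> + 1/4) * (SUP t\<in>{0..T}. norm (nth_vderiv {0..T} 2 \<psi> t))
      else 1/12 * (SUP t\<in>{0..T}. norm (nth_vderiv {0..T} 3 \<psi> t)))"

definition admissible_order ::
    "real \<Rightarrow> (real \<Rightarrow> 'a::real_normed_vector) \<Rightarrow> real \<Rightarrow> nat \<Rightarrow> bool" where
  "admissible_order T \<psi> \<zeta> s \<longleftrightarrow>
     s = 1 \<and> C_k_on 2 {0..T} \<psi> \<or> s = 2 \<and> \<zeta> = 1/2 \<and> C_k_on 3 {0..T} \<psi>"

end

theory Submission
  imports Defs
begin

text \<open>
  The proof is consistency plus stability. Write \<open>e\<^sub>k = \<psi>(t\<^sub>k) - u(\<theta>\<^sub>k)\<close> and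
  \<open>\<phi>\<^sub>k = f(t\<^sub>k, \<psi>(t\<^sub>k)) - f(t\<^sub>k, u(\<theta>\<^sub>k))\<close>. Inserting the exact solution into the scheme leaves the
  truncation error of the quadrature rule with weights \<open>\<zeta>, 1 - \<zeta>\<close>; inserting the computed one
  leaves the residual, whose norm is at most \<open>\<rho>\<close>. The difference of the two relations is
  \<open>e\<^sub>k\<^sub>+\<^sub>1 - e\<^sub>k - h (\<zeta> \<phi>\<^sub>k + (1 - \<zeta>) \<phi>\<^sub>k\<^sub>+\<^sub>1) = d\<^sub>k\<close> with \<open>\<parallel>d\<^sub>k\<parallel> \<le> h \<delta>\<close> and \<open>\<delta> = \<rho>/h + c\<^sub>s h\<^sup>s\<close>
  (\<open>dtp_error_recursion\<close>).

  The constants \<open>c\<^sub>s\<close> come from Peano kernels: the truncation error over a step is the increment of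
  an explicit combination of \<open>\<psi>\<close> and its derivatives whose own derivative is a scalar kernel times
  \<open>\<psi>''\<close> or \<open>\<psi>'''\<close>, and the mean value inequality integrates the absolute value of the kernel
  (\<open>theta_rule_error\<close>, \<open>trapezoidal_rule_error\<close>).

  It remains to propagate \<open>\<delta>\<close> over at most \<open>T / h\<close> steps.
  In the Lipschitz case, and for implicit Euler with \<open>\<ell> > 0\<close>, the norms \<open>\<parallel>e\<^sub>k\<parallel>\<close> satisfy
  \<open>(1 - b) a\<^sub>k\<^sub>+\<^sub>1 \<le> (1 + c) a\<^sub>k + h \<delta>\<close> with \<open>b + c = L h\<close>, and a discrete Gronwall argument applies
  (\<open>discrete_gronwall\<close>); the growth factor per step is at most \<open>exp (C L h)\<close> as soon as
  \<open>C (1 - b) \<ge> 1\<close>, which is what a sufficiently small step size has to guarantee.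
  For \<open>\<ell> \<le> 0\<close> the implicit Euler step does not amplify errors. In the dissipative case with
  \<open>\<zeta> \<le> 1/2\<close> the quantity that does not grow, apart from \<open>\<delta>\<close>, is not \<open>\<parallel>e\<^sub>k\<parallel>\<close> but the energy
  \<open>(\<parallel>e\<^sub>k\<parallel>\<^sup>2 + \<zeta>\<^sup>2 h\<^sup>2 \<parallel>\<phi>\<^sub>k\<parallel>\<^sup>2)\<^sup>1\<^sup>/\<^sup>2\<close>, which explains the form of \<open>E\<^sub>0\<close> there.
\<close>

section \<open>Truncation error of the quadrature rule\<close>

lemma C_k_on_has_vector_derivative:
  assumes "C_k_on n S g" "j < n" "t \<in> S"
  shows "(nth_vderiv S j g has_vector_derivative nth_vderiv S (Suc j) g t) (at t within S)"
  using assms by (simp add: C_k_on_def vector_derivative_works)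

lemma C_k_on_norm_le_SUP:
  fixes g :: "real \<Rightarrow> 'a::real_normed_vector"
  assumes "C_k_on n {a..b} g" "t \<in> {a..b}"
  shows "norm (nth_vderiv {a..b} n g t) \<le> (SUP t\<in>{a..b}. norm (nth_vderiv {a..b} n g t))"
proof (rule cSUP_upper)
  have "continuous_on {a..b} (\<lambda>t. norm (nth_vderiv {a..b} n g t))"
    using assms(1) by (intro continuous_on_norm) (simp add: C_k_on_def)
  then have "compact ((\<lambda>t. norm (nth_vderiv {a..b} n g t)) ` {a..b})"
    by (rule compact_continuous_image) simp
  then show "bdd_above ((\<lambda>t. norm (nth_vderiv {a..b} n g t)) ` {a..b})"
    by (intro bounded_imp_bdd_above compact_imp_bounded)
qed (use assms in simp)

lemma has_vector_derivative_mean_value_ineq: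
  fixes F :: "real \<Rightarrow> 'a::real_normed_vector" and \<Phi> :: "real \<Rightarrow> real"
  assumes "a \<le> b"
    and F: "\<And>x. x \<in> {a..b} \<Longrightarrow> (F has_vector_derivative F' x) (at x within {a..b})"
    and \<Phi>: "\<And>x. (\<Phi> has_real_derivative \<Phi>' x) (at x)"
    and le: "\<And>x. x \<in> {a..b} \<Longrightarrow> norm (F' x) \<le> \<Phi>' x"
  shows "norm (F b - F a) \<le> \<Phi> b - \<Phi> a"
proof (cases "a = b")
  case False
  with \<open>a \<le> b\<close> have "a < b" by simp
  then show ?thesis
  proof (rule differentiable_bound_general)
    show "continuous_on {a..b} F"
      using F by (intro continuous_on_vector_derivative) auto
    show "continuous_on {a..b} \<Phi>"
      using \<Phi> by (meson DERIV_isCont continuous_at_imp_continuous_on)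
  next
    fix x assume x: "a < x" "x < b"
    then have "(F has_vector_derivative F' x) (at x within {a..b})" by (intro F) auto
    moreover have "at x within {a..b} = at x"
      using x by (intro at_within_interior) auto
    ultimately show "(F has_vector_derivative F' x) (at x)" by simp
    show "(\<Phi> has_vector_derivative \<Phi>' x) (at x)"
      using \<Phi> by (simp add: has_real_derivative_iff_has_vector_derivative)
    show "norm (F' x) \<le> \<Phi>' x" using x by (intro le) auto
  qed
qed simp

text \<open>The truncation error is the increment of \<open>F(x) = g(x) + (z - x) g'(x)\<close> with \<open>z = a + \<zeta> h\<close>,
  and \<open>F'(x) = (z - x) g''(x)\<close>. The kernel changes sign at \<open>z\<close>, so the mean value inequality is applied
  on both sides of that point. The resulting constant is the integral of \<open>\<bar>z - x\<bar>\<close>,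
  namely \<open>h\<^sup>2 (\<zeta>\<^sup>2 + (1 - \<zeta>)\<^sup>2) / 2 = h\<^sup>2 (1/4 + (1/2 - \<zeta>)\<^sup>2)\<close>, and \<open>(1/2 - \<zeta>)\<^sup>2 \<le> \<bar>1/2 - \<zeta>\<bar>\<close>.\<close>

lemma theta_rule_error:
  fixes g :: "real \<Rightarrow> 'a::real_normed_vector"
  assumes "h \<ge> 0" "\<zeta> \<in> {0..1}"
    and g: "\<And>x. x \<in> {a..a+h} \<Longrightarrow> (g has_vector_derivative g' x) (at x within {a..a+h})"
    and g': "\<And>x. x \<in> {a..a+h} \<Longrightarrow> (g' has_vector_derivative g'' x) (at x within {a..a+h})"
    and bound: "\<And>x. x \<in> {a..a+h} \<Longrightarrow> norm (g'' x) \<le> m"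
  shows "norm (g (a+h) - g a - h *\<^sub>R (\<zeta> *\<^sub>R g' a + (1 - \<zeta>) *\<^sub>R g' (a+h)))
           \<le> h\<^sup>2 * ((\<bar>1/2 - \<zeta>\<bar> + 1/4) * m)"
proof -
  define z where "z = a + \<zeta> * h"
  define F where "F x = g x + (z - x) *\<^sub>R g' x" for x
  have F: "(F has_vector_derivative (z - x) *\<^sub>R g'' x) (at x within {a..a+h})"
    if "x \<in> {a..a+h}" for x
    unfolding F_def by (rule derivative_eq_intros g g' that refl | simp add: that)+
  have z: "a \<le> z" "z \<le> a + h"
    using assms(1,2) by (auto simp: z_def mult_left_le_one_le)
  have "m \<ge> 0" using order_trans[OF norm_ge_zero bound[of a]] assms(1) by simp
  have left: "norm (F z - F a) \<le> m * (- (z - z)\<^sup>2 / 2) - m * (- (z - a)\<^sup>2 / 2)"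
  proof (rule has_vector_derivative_mean_value_ineq[OF z(1)])
    fix x assume x: "x \<in> {a..z}"
    with z have x': "x \<in> {a..a+h}" by auto
    show "(F has_vector_derivative (z - x) *\<^sub>R g'' x) (at x within {a..z})"
      using F[OF x'] by (rule has_vector_derivative_within_subset) (use z in auto)
    show "norm ((z - x) *\<^sub>R g'' x) \<le> m * (z - x)"
      using mult_right_mono[OF bound[OF x'], of "z - x"] x by (simp add: mult.commute)
  qed (auto intro!: derivative_eq_intros simp: field_simps)
  have right: "norm (F (a+h) - F z) \<le> m * ((a + h - z)\<^sup>2 / 2) - m * ((z - z)\<^sup>2 / 2)"
  proof (rule has_vector_derivative_mean_value_ineq[OF z(2)])
    fix x assume x: "x \<in> {z..a+h}"
    with z have x': "x \<in> {a..a+h}" by auto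
    show "(F has_vector_derivative (z - x) *\<^sub>R g'' x) (at x within {z..a+h})"
      using F[OF x'] by (rule has_vector_derivative_within_subset) (use z in auto)
    show "norm ((z - x) *\<^sub>R g'' x) \<le> m * (x - z)"
      using mult_right_mono[OF bound[OF x'], of "x - z"] x by (simp add: mult.commute)
  qed (auto intro!: derivative_eq_intros simp: field_simps)
  have "g (a+h) - g a - h *\<^sub>R (\<zeta> *\<^sub>R g' a + (1 - \<zeta>) *\<^sub>R g' (a+h)) = (F z - F a) + (F (a+h) - F z)"
    by (simp add: F_def z_def algebra_simps)
  also have "norm \<dots> \<le> norm (F z - F a) + norm (F (a+h) - F z)"
    by (rule norm_triangle_ineq)
  also have "\<dots> \<le> h\<^sup>2 * (((1/2 - \<zeta>)\<^sup>2 + 1/4) * m)"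
    using left right by (simp add: z_def power2_eq_square field_simps)
  also have "\<dots> \<le> h\<^sup>2 * ((\<bar>1/2 - \<zeta>\<bar> + 1/4) * m)"
  proof -
    have "\<bar>1/2 - \<zeta>\<bar> \<le> 1" using assms(2) by auto
    from mult_left_le_one_le[OF _ _ this, of "\<bar>1/2 - \<zeta>\<bar>"]
    have "(1/2 - \<zeta>)\<^sup>2 \<le> \<bar>1/2 - \<zeta>\<bar>"
      by (metis abs_ge_zero abs_mult_self_eq power2_eq_square)
    then show ?thesis
      using \<open>m \<ge> 0\<close> by (intro mult_left_mono mult_right_mono) auto
  qed
  finally show ?thesis .
qed

text \<open>For \<open>\<zeta> = 1/2\<close> the kernel \<open>h/2 - (x - a)\<close> has mean zero. Integrating by parts once more moves a
  derivative onto \<open>g''\<close>: the term \<open>(x - a) (h - (x - a)) / 2 \<cdot> g''(x)\<close> vanishes at both ends, and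
  the new kernel is nonnegative with integral \<open>h\<^sup>3/12\<close>.\<close>

lemma trapezoidal_rule_error:
  fixes g :: "real \<Rightarrow> 'a::real_normed_vector"
  assumes "h \<ge> 0"
    and g: "\<And>x. x \<in> {a..a+h} \<Longrightarrow> (g has_vector_derivative g' x) (at x within {a..a+h})"
    and g': "\<And>x. x \<in> {a..a+h} \<Longrightarrow> (g' has_vector_derivative g'' x) (at x within {a..a+h})"
    and g'': "\<And>x. x \<in> {a..a+h} \<Longrightarrow> (g'' has_vector_derivative g''' x) (at x within {a..a+h})"
    and bound: "\<And>x. x \<in> {a..a+h} \<Longrightarrow> norm (g''' x) \<le> m"
  shows "norm (g (a+h) - g a - h *\<^sub>R ((1/2) *\<^sub>R g' a + (1/2) *\<^sub>R g' (a+h))) \<le> h ^ 3 * (1/12 * m)"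
proof -
  define F where
    "F x = g x + (h / 2 - (x - a)) *\<^sub>R g' x - ((x - a) * (h - (x - a)) / 2) *\<^sub>R g'' x" for x
  have "norm (F (a+h) - F a) \<le> m * (h * (a + h - a)\<^sup>2 / 4 - (a + h - a) ^ 3 / 6)
                              - m * (h * (a - a)\<^sup>2 / 4 - (a - a) ^ 3 / 6)"
  proof (rule has_vector_derivative_mean_value_ineq)
    fix x assume x: "x \<in> {a..a+h}"
    have *: "((\<lambda>x. (x - a) * (h - (x - a)) / 2) has_real_derivative h / 2 - (x - a))
               (at x within {a..a+h})"
      by (auto intro!: derivative_eq_intros simp: field_simps)
    have "(F has_vector_derivative
            g' x + ((h / 2 - (x - a)) *\<^sub>R g'' x + (- 1) *\<^sub>R g' x)
            - (((x - a) * (h - (x - a)) / 2) *\<^sub>R g''' x + (h / 2 - (x - a)) *\<^sub>R g'' x))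
          (at x within {a..a+h})"
      unfolding F_def
      by (intro has_vector_derivative_add has_vector_derivative_diff has_vector_derivative_scaleR
            g[OF x] g'[OF x] g''[OF x] *)
         (auto intro!: derivative_eq_intros)
    then show "(F has_vector_derivative - ((x - a) * (h - (x - a)) / 2) *\<^sub>R g''' x)
                 (at x within {a..a+h})"
      by (simp add: algebra_simps)
    have "0 \<le> (x - a) * (h - (x - a)) / 2" using x by simp
    moreover have "norm (- p *\<^sub>R g''' x) \<le> m * p" if "0 \<le> p" for p
      using mult_right_mono[OF bound[OF x] that] that by (simp add: mult.commute)
    ultimately show "norm (- ((x - a) * (h - (x - a)) / 2) *\<^sub>R g''' x)
                       \<le> m * ((x - a) * (h - (x - a)) / 2)"
      by blast
  next
    show "((\<lambda>x. m * (h * (x - a)\<^sup>2 / 4 - (x - a) ^ 3 / 6)) has_real_derivative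
             m * ((x - a) * (h - (x - a)) / 2)) (at x)" for x
      by (auto intro!: derivative_eq_intros simp: field_simps power2_eq_square)
  qed (use \<open>h \<ge> 0\<close> in simp)
  also have "F (a+h) - F a = g (a+h) - g a - h *\<^sub>R ((1/2) *\<^sub>R g' a + (1/2) *\<^sub>R g' (a+h))"
  proof -
    have "h / 2 - h = - (h / 2)" by simp
    then show ?thesis by (simp add: F_def algebra_simps)
  qed
  also have "m * (h * (a + h - a)\<^sup>2 / 4 - (a + h - a) ^ 3 / 6)
           - m * (h * (a - a)\<^sup>2 / 4 - (a - a) ^ 3 / 6) = h ^ 3 * (1/12 * m)"
    by (simp add: power2_eq_square power3_eq_cube)
  finally show ?thesis .
qed

lemma ivp_solution_nth_vderiv_1:
  assumes "ivp_solution T f \<psi>\<^sub>0 \<psi>" "t \<in> {0..T}" "T > 0"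
  shows "nth_vderiv {0..T} (Suc 0) \<psi> t = f t (\<psi> t)"
  using assms vector_derivative_within_cbox[of 0 T t \<psi> "f t (\<psi> t)"]
  by (auto simp: ivp_solution_def)

lemma ivp_truncation_error:
  fixes \<psi> :: "real \<Rightarrow> 'a::real_normed_vector"
  assumes "T > 0" and sol: "ivp_solution T f \<psi>\<^sub>0 \<psi>" and "\<zeta> \<in> {0..1}"
    and ord: "admissible_order T \<psi> \<zeta> s" and "h \<ge> 0" "a \<ge> 0" "a + h \<le> T"
  shows "norm (\<psi> (a+h) - \<psi> a - h *\<^sub>R (\<zeta> *\<^sub>R f a (\<psi> a) + (1 - \<zeta>) *\<^sub>R f (a+h) (\<psi> (a+h))))
           \<le> h * (trunc_const T \<psi> \<zeta> s * h ^ s)"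
proof -
  have sub: "{a..a+h} \<subseteq> {0..T}" using assms by auto
  have eq: "nth_vderiv {0..T} (Suc 0) \<psi> a = f a (\<psi> a)"
    "nth_vderiv {0..T} (Suc 0) \<psi> (a+h) = f (a+h) (\<psi> (a+h))"
    using assms by (auto intro!: ivp_solution_nth_vderiv_1[OF sol] simp del: nth_vderiv.simps)
  have D: "(nth_vderiv {0..T} j \<psi> has_vector_derivative nth_vderiv {0..T} (Suc j) \<psi> x)
             (at x within {a..a+h})" if "C_k_on n {0..T} \<psi>" "j < n" "x \<in> {a..a+h}" for n j x
    using that sub
    by (meson C_k_on_has_vector_derivative has_vector_derivative_within_subset subsetD)
  have B: "norm (nth_vderiv {0..T} n \<psi> x) \<le> (SUP t\<in>{0..T}. norm (nth_vderiv {0..T} n \<psi> t))"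
    if "C_k_on n {0..T} \<psi>" "x \<in> {a..a+h}" for n x
    using C_k_on_norm_le_SUP[OF that(1)] that(2) sub by blast
  from ord consider "s = 1" "C_k_on 2 {0..T} \<psi>" | "s = 2" "\<zeta> = 1/2" "C_k_on 3 {0..T} \<psi>"
    unfolding admissible_order_def by blast
  then show ?thesis
  proof cases
    case 1
    note D' = D[OF 1(2)] and B' = B[OF 1(2)]
    have "norm (nth_vderiv {0..T} 0 \<psi> (a+h) - nth_vderiv {0..T} 0 \<psi> a
                - h *\<^sub>R (\<zeta> *\<^sub>R nth_vderiv {0..T} (Suc 0) \<psi> a
                        + (1 - \<zeta>) *\<^sub>R nth_vderiv {0..T} (Suc 0) \<psi> (a+h)))
            \<le> h\<^sup>2 * ((\<bar>1/2 - \<zeta>\<bar> + 1/4) * (SUP t\<in>{0..T}. norm (nth_vderiv {0..T} 2 \<psi> t)))"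
      by (rule theta_rule_error[OF \<open>h \<ge> 0\<close> \<open>\<zeta> \<in> {0..1}\<close> D' D' B'[unfolded numeral_2_eq_2],
            folded numeral_2_eq_2]) auto
    then show ?thesis
      unfolding eq by (simp add: 1(1) trunc_const_def power2_eq_square mult_ac del: nth_vderiv.simps(2))
  next
    case 2
    note D' = D[OF 2(3)] and B' = B[OF 2(3)]
    have "norm (nth_vderiv {0..T} 0 \<psi> (a+h) - nth_vderiv {0..T} 0 \<psi> a
                - h *\<^sub>R ((1/2) *\<^sub>R nth_vderiv {0..T} (Suc 0) \<psi> a
                        + (1/2) *\<^sub>R nth_vderiv {0..T} (Suc 0) \<psi> (a+h)))
            \<le> h ^ 3 * (1/12 * (SUP t\<in>{0..T}. norm (nth_vderiv {0..T} 3 \<psi> t)))"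
      by (rule trapezoidal_rule_error[OF \<open>h \<ge> 0\<close> D' D' D' B'[unfolded numeral_3_eq_3],
            folded numeral_3_eq_3]) auto
    then show ?thesis
      unfolding eq
      by (simp add: 2(1,2) trunc_const_def power2_eq_square power3_eq_cube mult_ac del: nth_vderiv.simps(2))
  qed
qed

section \<open>Recursion for the error\<close>

lemma dtp_residual_le_rho:
  assumes "h > 0" "real (Suc k) * h \<le> T"
  shows "norm (dtp_residual f u h \<zeta> (k::nat) (\<theta> k) (\<theta> (Suc k))) \<le> dtp_rho T f u h \<zeta> \<theta>"
proof -
  have "{k. real (Suc k) * h \<le> T} \<subseteq> {..nat \<lceil>T / h\<rceil>}"
  proof
    fix k assume "k \<in> {k. real (Suc k) * h \<le> T}"
    with \<open>h > 0\<close> have "real k \<le> T / h" by (auto simp: field_simps)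
    then show "k \<in> {..nat \<lceil>T / h\<rceil>}" by simp linarith
  qed
  then have "finite {k. real (Suc k) * h \<le> T}" by (rule finite_subset) simp
  then have "finite ((\<lambda>k. norm (dtp_residual f u h \<zeta> k (\<theta> k) (\<theta> (Suc k))))
                       ` {k. real (Suc k) * h \<le> T})"
    by (rule finite_imageI)
  then show ?thesis
    unfolding dtp_rho_def setcompr_eq_image by (rule Max_ge) (use assms in auto)
qed

lemma dtp_error_recursion:
  fixes \<psi> :: "real \<Rightarrow> 'a::real_normed_vector" and u :: "'b \<Rightarrow> 'a" and \<theta> :: "nat \<Rightarrow> 'b"
  assumes "T > 0" "ivp_solution T f \<psi>\<^sub>0 \<psi>" "\<zeta> \<in> {0..1}" "admissible_order T \<psi> \<zeta> s"
    and "h > 0" "real (Suc k) * h \<le> T"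
  defines "e \<equiv> \<lambda>k. \<psi> (real k * h) - u (\<theta> k)"
    and "\<phi> \<equiv> \<lambda>k. f (real k * h) (\<psi> (real k * h)) - f (real k * h) (u (\<theta> k))"
  shows "norm (e (Suc k) - e k - h *\<^sub>R (\<zeta> *\<^sub>R \<phi> k + (1 - \<zeta>) *\<^sub>R \<phi> (Suc k)))
           \<le> h * (dtp_rho T f u h \<zeta> \<theta> / h + trunc_const T \<psi> \<zeta> s * h ^ s)"
proof -
  define t t' where "t = real k * h" and "t' = real (Suc k) * h"
  have t': "t + h = t'" by (simp add: t_def t'_def algebra_simps)
  have "e (Suc k) - e k - h *\<^sub>R (\<zeta> *\<^sub>R \<phi> k + (1 - \<zeta>) *\<^sub>R \<phi> (Suc k))
      = (\<psi> t' - \<psi> t - h *\<^sub>R (\<zeta> *\<^sub>R f t (\<psi> t) + (1 - \<zeta>) *\<^sub>R f t' (\<psi> t')))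
        - dtp_residual f u h \<zeta> k (\<theta> k) (\<theta> (Suc k))"
    unfolding e_def \<phi>_def dtp_residual_def t_def[symmetric] t'_def[symmetric]
    by (simp add: scaleR_right_distrib scaleR_right_diff_distrib)
  also have "norm \<dots> \<le> h * (trunc_const T \<psi> \<zeta> s * h ^ s) + dtp_rho T f u h \<zeta> \<theta>"
  proof (rule order_trans[OF norm_triangle_ineq4 add_mono])
    show "norm (\<psi> t' - \<psi> t - h *\<^sub>R (\<zeta> *\<^sub>R f t (\<psi> t) + (1 - \<zeta>) *\<^sub>R f t' (\<psi> t')))
            \<le> h * (trunc_const T \<psi> \<zeta> s * h ^ s)"
      unfolding t'[symmetric] using assms(1-6) t'
      by (intro ivp_truncation_error) (auto simp: t_def t'_def)
  qed (rule dtp_residual_le_rho[OF assms(5,6)])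
  also have "\<dots> = h * (dtp_rho T f u h \<zeta> \<theta> / h + trunc_const T \<psi> \<zeta> s * h ^ s)"
    using \<open>h > 0\<close> by (simp add: field_simps)
  finally show ?thesis .
qed

section \<open>Scalar recursions\<close>

text \<open>The fixed point of \<open>(1 - b) a = (1 + c) a + h \<delta>\<close> is \<open>- \<delta> / L\<close>, so the shifted sequence
  \<open>a\<^sub>k + \<delta> / L\<close> obeys the homogeneous recursion with factor \<open>(1 + c) / (1 - b) = 1 + L h / (1 - b)\<close>.\<close>

lemma discrete_gronwall:
  fixes a :: "nat \<Rightarrow> real"
  assumes step: "\<And>k. k < n \<Longrightarrow> (1 - b) * a (Suc k) \<le> (1 + c) * a k + h * \<delta>"
    and "L > 0" "h \<ge> 0" "c \<ge> 0" "\<delta> \<ge> 0" "a 0 \<ge> 0" and bc: "b + c = L * h"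
    and C: "C * (1 - b) \<ge> 1" "C > 0" and "real n * h \<le> T"
  shows "a n \<le> exp (C * L * T) * a 0 + exp (C * L * T) / L * \<delta>"
proof -
  have b: "1 - b > 0" using C by (smt (verit) mult_pos_neg mult_nonneg_nonpos)
  have factor: "1 + c \<le> (1 - b) * exp (C * L * h)"
  proof -
    have "1 + c = (1 - b) + L * h" using bc by simp
    also have "\<dots> \<le> (1 - b) + L * h * (C * (1 - b))"
      using C(1) \<open>L > 0\<close> \<open>h \<ge> 0\<close> mult_left_mono[OF C(1), of "L * h"] by simp
    also have "\<dots> = (1 - b) * (1 + C * L * h)" by (simp add: algebra_simps)
    also have "\<dots> \<le> (1 - b) * exp (C * L * h)"
      using b by (intro mult_left_mono exp_ge_add_one_self) auto
    finally show ?thesis .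
  qed
  have "a k + \<delta> / L \<le> exp (C * L * h) ^ k * (a 0 + \<delta> / L)" if "k \<le> n" for k
    using that
  proof (induction k)
    case (Suc k)
    define B where "B = exp (C * L * h) ^ k * (a 0 + \<delta> / L)"
    have "B \<ge> 0" unfolding B_def using assms by simp
    have "(1 - b) * (a (Suc k) + \<delta> / L) = (1 - b) * a (Suc k) + (1 - b) * (\<delta> / L)"
      by (simp add: algebra_simps)
    also have "\<dots> \<le> (1 + c) * a k + h * \<delta> + (1 - b) * (\<delta> / L)"
      using step[of k] Suc.prems by simp
    also have "\<dots> = (1 + c) * (a k + \<delta> / L)"
    proof -
      have "h * \<delta> = (b + c) * (\<delta> / L)" using bc \<open>L > 0\<close> by simp
      then show ?thesis by (simp only: distrib_left distrib_right left_diff_distrib mult_1_left)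
    qed
    also have "\<dots> \<le> (1 + c) * B"
      using Suc \<open>c \<ge> 0\<close> by (intro mult_left_mono) (auto simp: B_def)
    also have "\<dots> \<le> (1 - b) * exp (C * L * h) * B"
      using factor \<open>B \<ge> 0\<close> by (rule mult_right_mono)
    finally have "a (Suc k) + \<delta> / L \<le> exp (C * L * h) * B"
      using b by (simp add: mult.assoc)
    then show ?case by (simp add: B_def mult.assoc)
  qed simp
  from this[of n] have "a n + \<delta> / L \<le> exp (C * L * (real n * h)) * (a 0 + \<delta> / L)"
    by (simp add: exp_of_nat_mult[symmetric] mult_ac)
  also have "\<dots> \<le> exp (C * L * T) * (a 0 + \<delta> / L)"
    using assms by (intro mult_right_mono) auto
  finally have "a n + \<delta> / L \<le> exp (C * L * T) * (a 0 + \<delta> / L)" .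
  moreover have "0 \<le> \<delta> / L" using assms by simp
  ultimately show ?thesis by (simp add: algebra_simps)
qed

lemma increment_bound_accumulates:
  fixes a :: "nat \<Rightarrow> real"
  assumes step: "\<And>k. k < n \<Longrightarrow> a (Suc k) \<le> a k + h * \<delta>" and "\<delta> \<ge> 0" "real n * h \<le> T"
  shows "a n \<le> a 0 + T * \<delta>"
proof -
  have "a k \<le> a 0 + real k * (h * \<delta>)" if "k \<le> n" for k
    using that
  proof (induction k)
    case (Suc k)
    then show ?case using step[of k] by (simp add: algebra_simps)
  qed simp
  then have "a n \<le> a 0 + real n * h * \<delta>" by (simp add: mult.assoc)
  also have "\<dots> \<le> a 0 + T * \<delta>" using assms by (intro add_left_mono mult_right_mono) auto
  finally show ?thesis .
qed

text \<open>The bound \<open>a\<^sub>0 + \<delta> / L\<close> is reproduced by each step, because \<open>\<delta> / L\<close> is the fixed point.\<close>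

lemma contractive_recursion_bound:
  fixes a :: "nat \<Rightarrow> real"
  assumes step: "\<And>k. k < n \<Longrightarrow> (1 + h * L) * a (Suc k) \<le> a k + h * \<delta>"
    and "L > 0" "h \<ge> 0" "\<delta> \<ge> 0" "a 0 \<ge> 0"
  shows "a n \<le> a 0 + 1 / L * \<delta>"
proof -
  have "a k \<le> a 0 + 1 / L * \<delta>" if "k \<le> n" for k
    using that
  proof (induction k)
    case (Suc k)
    then have "(1 + h * L) * a (Suc k) \<le> a 0 + 1 / L * \<delta> + h * \<delta>"
      using step[of k] by simp
    also have "\<dots> \<le> a 0 + 1 / L * \<delta> + h * \<delta> + h * L * a 0" using assms by simp
    also have "\<dots> = (1 + h * L) * (a 0 + 1 / L * \<delta>)"
      using \<open>L > 0\<close> by (simp add: field_simps)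
    finally show ?case
      using assms by (simp add: add_pos_nonneg)
  qed (use assms in simp)
  then show ?thesis by simp
qed

section \<open>Geometry of the implicit step\<close>

text \<open>The real part of a complex inner product is a real inner product inducing the same norm.\<close>

lemma norm_add_scaleR_sq:
  fixes x y :: "'a::complex_hilbert_space"
  shows "(norm (x + r *\<^sub>R y))\<^sup>2 = (norm x)\<^sup>2 + 2 * r * Re (cinner y x) + r\<^sup>2 * (norm y)\<^sup>2"
proof -
  have sq: "(norm z)\<^sup>2 = Re (cinner z z)" for z :: 'a
    by (simp add: norm_eq_sqrt_cinner cinner_ge_zero)
  have sym: "Re (cinner v w) = Re (cinner w v)" for v w :: 'a
    using cinner_commute[of v w] by simp
  have add: "Re (cinner v (w + z)) = Re (cinner v w) + Re (cinner v z)" for v w z :: 'a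
    by (simp add: cinner_add_right)
  have scale: "Re (cinner v (r *\<^sub>R w)) = r * Re (cinner v w)" for v w :: 'a
    by (simp add: scaleR_scaleC cinner_scaleC_right)
  have "Re (cinner (r *\<^sub>R y) (r *\<^sub>R y)) = r\<^sup>2 * Re (cinner y y)"
    by (simp add: scale sym[of "r *\<^sub>R y"] power2_eq_square)
  moreover have "Re (cinner (x + r *\<^sub>R y) (x + r *\<^sub>R y))
      = Re (cinner x x) + 2 * Re (cinner x (r *\<^sub>R y)) + Re (cinner (r *\<^sub>R y) (r *\<^sub>R y))"
    by (simp add: add sym[of "x + r *\<^sub>R y"] sym[of "r *\<^sub>R y" x])
  ultimately show ?thesis
    by (simp add: sq scale sym[of x y])
qed

text \<open>Pairing \<open>e - h \<phi>\<close> with \<open>e\<close> gives \<open>(1 - h \<ell>) \<parallel>e\<parallel>\<^sup>2 \<le> Re \<langle>e - h \<phi>, e\<rangle>\<close>; then cancel \<open>\<parallel>e\<parallel>\<close>. The Cauchy-Schwarz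
  inequality used here is the square of the triangle inequality for \<open>e - h \<phi>\<close> and \<open>e\<close>.\<close>

lemma implicit_euler_resolvent_bound:
  fixes e \<phi> :: "'a::complex_hilbert_space"
  assumes "Re (cinner \<phi> e) \<le> l * (norm e)\<^sup>2" "h \<ge> 0"
  shows "(1 - h * l) * norm e \<le> norm (e - h *\<^sub>R \<phi>)"
proof (cases "e = 0")
  case False
  define w where "w = e - h *\<^sub>R \<phi>"
  have sq_w: "(norm w)\<^sup>2 = (norm e)\<^sup>2 - 2 * h * Re (cinner \<phi> e) + h\<^sup>2 * (norm \<phi>)\<^sup>2"
    using norm_add_scaleR_sq[of e "- h" \<phi>] by (simp add: w_def)
  have "w + e = 2 *\<^sub>R (e + (- h / 2) *\<^sub>R \<phi>)"
    by (simp only: w_def scaleR_right_distrib scaleR_scaleR) (simp add: scaleR_2)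
  then have "(norm (w + e))\<^sup>2 = 4 * (norm (e + (- h / 2) *\<^sub>R \<phi>))\<^sup>2"
    by (simp add: power2_eq_square)
  also have "\<dots> = 4 * (norm e)\<^sup>2 - 4 * h * Re (cinner \<phi> e) + h\<^sup>2 * (norm \<phi>)\<^sup>2"
    unfolding norm_add_scaleR_sq by (simp add: field_simps power2_eq_square)
  finally have "4 * (norm e)\<^sup>2 - 4 * h * Re (cinner \<phi> e) + h\<^sup>2 * (norm \<phi>)\<^sup>2 \<le> (norm w + norm e)\<^sup>2"
    by (metis norm_ge_zero norm_triangle_ineq power_mono)
  then have "(norm e)\<^sup>2 - h * Re (cinner \<phi> e) \<le> norm w * norm e"
    using sq_w by (simp add: power2_sum)
  moreover have "h * Re (cinner \<phi> e) \<le> h * (l * (norm e)\<^sup>2)"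
    using assms by (intro mult_left_mono)
  ultimately have "(1 - h * l) * norm e * norm e \<le> norm w * norm e"
    by (simp add: power2_eq_square algebra_simps)
  then show ?thesis using False by (simp add: w_def)
qed simp

text \<open>If \<open>Re \<langle>\<phi>, e\<rangle> \<le> 0\<close>, the cross term helps on both sides: it can be dropped from the
  implicit half \<open>e - (1 - \<zeta>) h \<phi>\<close> as a lower bound and from the explicit half \<open>e + \<zeta> h \<phi>\<close> as an
  upper bound. For \<open>\<zeta> \<le> 1/2\<close> the implicit weight dominates the explicit one, so both halves are
  comparable with the same energy \<open>\<parallel>e\<parallel>\<^sup>2 + \<zeta>\<^sup>2 h\<^sup>2 \<parallel>\<phi>\<parallel>\<^sup>2\<close>.\<close>

lemma dissipative_energy_bounds:
  fixes e \<phi> :: "'a::complex_hilbert_space"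
  assumes "Re (cinner \<phi> e) \<le> 0" "\<zeta> \<ge> 0" "\<zeta> \<le> 1/2" "h \<ge> 0"
  shows "norm (e + (h * \<zeta>) *\<^sub>R \<phi>) \<le> sqrt ((norm e)\<^sup>2 + \<zeta>\<^sup>2 * h\<^sup>2 * (norm \<phi>)\<^sup>2)"
    and "sqrt ((norm e)\<^sup>2 + \<zeta>\<^sup>2 * h\<^sup>2 * (norm \<phi>)\<^sup>2) \<le> norm (e - (h * (1 - \<zeta>)) *\<^sub>R \<phi>)"
proof -
  have "2 * (h * \<zeta>) * Re (cinner \<phi> e) \<le> 0"
    using assms by (intro mult_nonneg_nonpos) auto
  then have "(norm (e + (h * \<zeta>) *\<^sub>R \<phi>))\<^sup>2 \<le> (norm e)\<^sup>2 + \<zeta>\<^sup>2 * h\<^sup>2 * (norm \<phi>)\<^sup>2"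
    by (simp add: norm_add_scaleR_sq power_mult_distrib mult_ac)
  then show "norm (e + (h * \<zeta>) *\<^sub>R \<phi>) \<le> sqrt ((norm e)\<^sup>2 + \<zeta>\<^sup>2 * h\<^sup>2 * (norm \<phi>)\<^sup>2)"
    by (rule real_le_rsqrt)
  have "2 * (h * (1 - \<zeta>)) * Re (cinner \<phi> e) \<le> 0"
    using assms by (intro mult_nonneg_nonpos) auto
  moreover have "\<zeta>\<^sup>2 * h\<^sup>2 * (norm \<phi>)\<^sup>2 \<le> (1 - \<zeta>)\<^sup>2 * h\<^sup>2 * (norm \<phi>)\<^sup>2"
    using assms by (intro mult_right_mono power_mono) auto
  ultimately have "(norm e)\<^sup>2 + \<zeta>\<^sup>2 * h\<^sup>2 * (norm \<phi>)\<^sup>2 \<le> (norm (e - (h * (1 - \<zeta>)) *\<^sub>R \<phi>))\<^sup>2"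
    using norm_add_scaleR_sq[of e "- (h * (1 - \<zeta>))" \<phi>]
    by (simp add: power_mult_distrib mult_ac)
  then show "sqrt ((norm e)\<^sup>2 + \<zeta>\<^sup>2 * h\<^sup>2 * (norm \<phi>)\<^sup>2) \<le> norm (e - (h * (1 - \<zeta>)) *\<^sub>R \<phi>)"
    by (rule real_le_lsqrt[rotated 1]) simp_all
qed

section \<open>Error propagation in the three cases\<close>

lemma lipschitz_error_bound:
  fixes e \<phi> :: "nat \<Rightarrow> 'a::real_normed_vector"
  assumes rec: "\<And>k. k < n \<Longrightarrow>
      norm (e (Suc k) - e k - h *\<^sub>R (\<zeta> *\<^sub>R \<phi> k + (1 - \<zeta>) *\<^sub>R \<phi> (Suc k))) \<le> h * \<delta>"
    and lip: "\<And>k. k \<le> n \<Longrightarrow> norm (\<phi> k) \<le> L * norm (e k)"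
    and "\<zeta> \<in> {0..1}" "h \<ge> 0" "\<delta> \<ge> 0" "L > 0" "real n * h \<le> T"
    and C: "C * (1 - L * (1 - \<zeta>) * h) \<ge> 1" "C > 0"
  shows "norm (e n) \<le> exp (C * L * T) * norm (e 0) + exp (C * L * T) / L * \<delta>"
proof (rule discrete_gronwall[where b = "L * (1 - \<zeta>) * h" and c = "L * \<zeta> * h"
        and a = "\<lambda>k. norm (e k)" and h = h])
  fix k assume k: "k < n"
  define d where "d = e (Suc k) - e k - h *\<^sub>R (\<zeta> *\<^sub>R \<phi> k + (1 - \<zeta>) *\<^sub>R \<phi> (Suc k))"
  have "e (Suc k) = e k + (h * \<zeta>) *\<^sub>R \<phi> k + (h * (1 - \<zeta>)) *\<^sub>R \<phi> (Suc k) + d"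
    by (simp add: d_def scaleR_right_distrib)
  then have "norm (e (Suc k)) \<le> norm (e k) + norm ((h * \<zeta>) *\<^sub>R \<phi> k) + norm ((h * (1 - \<zeta>)) *\<^sub>R \<phi> (Suc k)) + norm d"
    by (simp only:) (intro norm_triangle_mono order_refl)
  also have "\<dots> = norm (e k) + h * \<zeta> * norm (\<phi> k) + h * (1 - \<zeta>) * norm (\<phi> (Suc k)) + norm d"
    using assms(3,4) by simp
  also have "\<dots> \<le> norm (e k) + h * \<zeta> * (L * norm (e k))
                   + h * (1 - \<zeta>) * (L * norm (e (Suc k))) + h * \<delta>"
    using assms(3,4) k rec[OF k] by (intro add_mono mult_left_mono lip) (auto simp: d_def)
  finally show "(1 - L * (1 - \<zeta>) * h) * norm (e (Suc k)) \<le> (1 + L * \<zeta> * h) * norm (e k) + h * \<delta>"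
    by (simp add: algebra_simps)
qed (use assms in \<open>auto simp: algebra_simps\<close>)

lemma implicit_euler_error_step:
  fixes e e' \<phi> :: "'a::complex_hilbert_space"
  assumes "norm (e' - e - h *\<^sub>R \<phi>) \<le> h * \<delta>" "Re (cinner \<phi> e') \<le> l * (norm e')\<^sup>2" "h \<ge> 0"
  shows "(1 - h * l) * norm e' \<le> norm e + h * \<delta>"
proof -
  have "(1 - h * l) * norm e' \<le> norm (e' - h *\<^sub>R \<phi>)"
    using assms(2,3) by (rule implicit_euler_resolvent_bound)
  also have "e' - h *\<^sub>R \<phi> = e + (e' - e - h *\<^sub>R \<phi>)" by simp
  also have "norm \<dots> \<le> norm e + h * \<delta>"
    using assms(1) by (rule norm_triangle_mono[OF order_refl])
  finally show ?thesis .
qed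

lemma dissipative_error_bound:
  fixes e \<phi> :: "nat \<Rightarrow> 'a::complex_hilbert_space"
  assumes rec: "\<And>k. k < n \<Longrightarrow>
      norm (e (Suc k) - e k - h *\<^sub>R (\<zeta> *\<^sub>R \<phi> k + (1 - \<zeta>) *\<^sub>R \<phi> (Suc k))) \<le> h * \<delta>"
    and diss: "\<And>k. k \<le> n \<Longrightarrow> Re (cinner (\<phi> k) (e k)) \<le> 0"
    and "\<zeta> \<ge> 0" "\<zeta> \<le> 1/2" "h \<ge> 0" "\<delta> \<ge> 0" "real n * h \<le> T"
  shows "norm (e n) \<le> sqrt ((norm (e 0))\<^sup>2 + \<zeta>\<^sup>2 * h\<^sup>2 * (norm (\<phi> 0))\<^sup>2) + T * \<delta>"
proof -
  define N where "N k = sqrt ((norm (e k))\<^sup>2 + \<zeta>\<^sup>2 * h\<^sup>2 * (norm (\<phi> k))\<^sup>2)" for k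
  have "N (Suc k) \<le> N k + h * \<delta>" if k: "k < n" for k
  proof -
    have "N (Suc k) \<le> norm (e (Suc k) - (h * (1 - \<zeta>)) *\<^sub>R \<phi> (Suc k))"
      unfolding N_def using assms k by (intro dissipative_energy_bounds) auto
    also have "e (Suc k) - (h * (1 - \<zeta>)) *\<^sub>R \<phi> (Suc k) = (e k + (h * \<zeta>) *\<^sub>R \<phi> k)
        + (e (Suc k) - e k - h *\<^sub>R (\<zeta> *\<^sub>R \<phi> k + (1 - \<zeta>) *\<^sub>R \<phi> (Suc k)))"
      by (simp add: scaleR_right_distrib)
    also have "norm \<dots> \<le> N k + h * \<delta>"
      unfolding N_def using assms k
      by (intro norm_triangle_mono dissipative_energy_bounds rec) auto
    finally show ?thesis .
  qed
  then have "N n \<le> N 0 + T * \<delta>"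
    using assms by (intro increment_bound_accumulates)
  moreover have "norm (e n) \<le> N n"
    unfolding N_def by (rule real_le_rsqrt) simp
  ultimately show ?thesis by (simp add: N_def)
qed

section \<open>The error estimate\<close>

text \<open>For the Lipschitz case the threshold is \<open>h\<^sub>0 = (1 - 1/C) / L\<close>: for \<open>h < h\<^sub>0\<close> one has
  \<open>L (1 - \<zeta>) h \<le> 1 - 1/C\<close>, which is \<open>C (1 - L (1 - \<zeta>) h) \<ge> 1\<close>. The condition \<open>L (1 - \<zeta>) h < 1/C\<close>
  implies this only for \<open>C \<ge> 2\<close>. Implicit Euler with \<open>\<ell> > 0\<close> obeys the same recursion
  with \<open>C = 2\<close>, where \<open>C (1 - \<ell> h) \<ge> 1\<close> is the restriction \<open>\<ell> h \<le> 1/2\<close>.\<close>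

theorem theorem4p1:
  "\<exists>h\<^sub>0 :: real \<Rightarrow> real \<Rightarrow> real \<Rightarrow> real.
     (\<forall>L>0. \<forall>\<zeta>\<in>{0..1}. \<forall>C>1. h\<^sub>0 L \<zeta> C > 0) \<and>
     (\<forall>(T::real) (f :: real \<Rightarrow> 'a \<Rightarrow> 'a::complex_hilbert_space) \<psi>\<^sub>0 \<psi>
        (\<Theta> :: (complex ^ 'p) set) (u :: complex ^ 'p \<Rightarrow> 'a)
        (\<zeta>::real) (s::nat) (h::real) \<theta> (M::real) (E\<^sub>0::real).
        T > 0 \<longrightarrow> ivp_solution T f \<psi>\<^sub>0 \<psi> \<longrightarrow>
        \<zeta> \<in> {0..1} \<longrightarrow> admissible_order T \<psi> \<zeta> s \<longrightarrow>
        h > 0 \<longrightarrow> dtp_sequence T f \<Theta> u h \<zeta> \<theta> \<longrightarrow>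
        ((\<exists>L C C\<^sub>0. L > 0 \<and>
            (\<forall>t\<in>{0..T}. \<forall>v w. norm (f t v - f t w) \<le> L * norm (v - w)) \<and>
            C > 1 \<and> L * (1 - \<zeta>) * h < 1 / C \<and> h < h\<^sub>0 L \<zeta> C \<and>
            C\<^sub>0 = exp (C * L * T) \<and> M = C\<^sub>0 / L \<and>
            E\<^sub>0 = C\<^sub>0 * norm (\<psi> 0 - u (\<theta> 0))) \<or>
        (\<exists>l C\<^sub>0. one_sided_lipschitz T f l \<and> \<zeta> = 0 \<and> s = 1 \<and> l * h \<le> 1 / 2 \<and>
            (C\<^sub>0, M) = (if l = 0 then (1, T)
                       else if l < 0 then (1, 1 / \<bar>l\<bar>)
                       else (exp (2 * l * T), exp (2 * l * T) * (1 / l))) \<and>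
            E\<^sub>0 = C\<^sub>0 * norm (\<psi> 0 - u (\<theta> 0))) \<or>
        (one_sided_lipschitz T f 0 \<and> \<zeta> \<le> 1 / 2 \<and> M = T \<and> E\<^sub>0 \<ge> 0 \<and>
            E\<^sub>0\<^sup>2 = (norm (\<psi> 0 - u (\<theta> 0)))\<^sup>2
                  + \<zeta>\<^sup>2 * h\<^sup>2 * (norm (f 0 (\<psi> 0) - f 0 (u (\<theta> 0))))\<^sup>2)) \<longrightarrow>
        (\<forall>k. real (Suc k) * h \<le> T \<longrightarrow>
            norm (\<psi> (real k * h) - u (\<theta> k))
              \<le> E\<^sub>0 + M * (dtp_rho T f u h \<zeta> \<theta> / h + trunc_const T \<psi> \<zeta> s * h ^ s)))"
proof (intro exI[where x = "\<lambda>L \<zeta> C. (1 - 1 / C) / L"] conjI allI ballI impI, goal_cases)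
  case (1 L \<zeta> C)
  then show ?case by simp
next
  case (2 T f \<psi>\<^sub>0 \<psi> \<Theta> u \<zeta> s h \<theta> M E\<^sub>0 n)
  define e where "e k = \<psi> (real k * h) - u (\<theta> k)" for k
  define \<phi> where "\<phi> k = f (real k * h) (\<psi> (real k * h)) - f (real k * h) (u (\<theta> k))" for k
  define \<delta> where "\<delta> = dtp_rho T f u h \<zeta> \<theta> / h + trunc_const T \<psi> \<zeta> s * h ^ s"
  note \<open>T > 0\<close> \<open>h > 0\<close> and \<zeta> = \<open>\<zeta> \<in> {0..1}\<close>
  have grid_le: "real k * h \<le> T" if "k \<le> Suc n" for k
    using that \<open>real (Suc n) * h \<le> T\<close> \<open>h > 0\<close>
    by (meson less_imp_le mult_right_mono of_nat_le_iff order_trans)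
  then have grid: "real k * h \<in> {0..T}" if "k \<le> n" for k
    using that \<open>h > 0\<close> by simp
  have nT: "real n * h \<le> T" by (rule grid_le) simp
  have rec: "norm (e (Suc k) - e k - h *\<^sub>R (\<zeta> *\<^sub>R \<phi> k + (1 - \<zeta>) *\<^sub>R \<phi> (Suc k))) \<le> h * \<delta>"
    if "k \<le> n" for k
    unfolding e_def \<phi>_def \<delta>_def using 2 grid_le[of "Suc k"] that
    by (intro dtp_error_recursion) auto
  \<comment> \<open>The recursion is available up to index \<open>n\<close>, so even for \<open>n = 0\<close> it yields the sign of \<open>\<delta>\<close>.\<close>
  have "0 \<le> h * \<delta>" using rec[of 0] by (meson norm_ge_zero order_trans zero_le)
  with \<open>h > 0\<close> have \<delta>: "\<delta> \<ge> 0" by (simp add: zero_le_mult_iff)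
  have e0: "e 0 = \<psi> 0 - u (\<theta> 0)" and \<phi>0: "\<phi> 0 = f 0 (\<psi> 0) - f 0 (u (\<theta> 0))"
    by (simp_all add: e_def \<phi>_def)
  have osl: "Re (cinner (\<phi> k) (e k)) \<le> l * (norm (e k))\<^sup>2"
    if "one_sided_lipschitz T f l" "k \<le> n" for l k
    using that grid[of k] by (simp add: one_sided_lipschitz_def e_def \<phi>_def)
  from 2(7) have "norm (e n) \<le> E\<^sub>0 + M * \<delta>"
  proof (elim disjE exE conjE, goal_cases)
    case (1 L C C\<^sub>0)
    have "L * h < 1 - 1 / C"
      using \<open>h < (1 - 1 / C) / L\<close> \<open>L > 0\<close> by (simp add: field_simps)
    moreover have "L * (1 - \<zeta>) * h \<le> L * 1 * h"
      using \<zeta> \<open>L > 0\<close> \<open>h > 0\<close> by (intro mult_right_mono mult_left_mono) auto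
    ultimately have "1 / C \<le> 1 - L * (1 - \<zeta>) * h" by simp
    then have C: "C * (1 - L * (1 - \<zeta>) * h) \<ge> 1"
      using \<open>C > 1\<close> by (simp add: field_simps)
    have "norm (e n) \<le> exp (C * L * T) * norm (e 0) + exp (C * L * T) / L * \<delta>"
    proof (rule lipschitz_error_bound[where \<phi> = \<phi> and \<zeta> = \<zeta> and h = h])
      show "norm (\<phi> k) \<le> L * norm (e k)" if "k \<le> n" for k
        using 1(2) grid[OF that] by (simp add: e_def \<phi>_def)
    qed (use rec \<zeta> \<delta> nT C \<open>C > 1\<close> \<open>L > 0\<close> \<open>h > 0\<close> in auto)
    then show ?case using 1 by (simp add: e0)
  next
    case (2 l C\<^sub>0)
    have step: "(1 - h * l) * norm (e (Suc k)) \<le> norm (e k) + h * \<delta>" if "k < n" for k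
      using rec[of k] that \<open>\<zeta> = 0\<close> \<open>h > 0\<close> osl[OF 2(1), of "Suc k"]
      by (intro implicit_euler_error_step[where \<phi> = "\<phi> (Suc k)"]) auto
    consider "l = 0" | "l < 0" | "l > 0" by linarith
    then show ?case
    proof cases
      case 1
      have "norm (e n) \<le> norm (e 0) + T * \<delta>"
        using step \<delta> nT 1 by (intro increment_bound_accumulates[where h = h]) auto
      then show ?thesis using 1 2 by (simp add: e0)
    next
      case 2
      have "norm (e n) \<le> norm (e 0) + 1 / \<bar>l\<bar> * \<delta>"
        using step \<delta> \<open>h > 0\<close> 2
        by (intro contractive_recursion_bound[where h = h]) (auto simp: abs_if)
      then show ?thesis using 2 \<open>(C\<^sub>0, M) = _\<close> \<open>E\<^sub>0 = _\<close> by (simp add: e0)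
    next
      case 3
      have "norm (e n) \<le> exp (2 * l * T) * norm (e 0) + exp (2 * l * T) / l * \<delta>"
        using step \<delta> nT \<open>h > 0\<close> 3 \<open>l * h \<le> 1 / 2\<close>
        by (intro discrete_gronwall[where h = h and b = "h * l" and c = 0])
           (auto simp: mult_ac)
      then show ?thesis using 3 \<open>(C\<^sub>0, M) = _\<close> \<open>E\<^sub>0 = _\<close> by (simp add: e0)
    qed
  next
    case 3
    have "norm (e n) \<le> sqrt ((norm (e 0))\<^sup>2 + \<zeta>\<^sup>2 * h\<^sup>2 * (norm (\<phi> 0))\<^sup>2) + T * \<delta>"
      using rec osl[OF 3(1)] 3 \<zeta> \<open>h > 0\<close> \<delta> nT by (intro dissipative_error_bound) auto
    also have "(norm (e 0))\<^sup>2 + \<zeta>\<^sup>2 * h\<^sup>2 * (norm (\<phi> 0))\<^sup>2 = E\<^sub>0\<^sup>2"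
      using 3 by (simp add: e0 \<phi>0)
    finally have "norm (e n) \<le> \<bar>E\<^sub>0\<bar> + T * \<delta>" by (simp only: real_sqrt_abs)
    then show ?case using 3 by simp
  qed
  then show ?case by (simp add: e_def \<delta>_def)
qed

end
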